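(* Suppose all queues are initially empty, i.e. $Q_i(0)=S_i(0)=Z_i(0)=0$ for all $i\in\mathcal N$. Under the online algorithm with control parameter $V\ge 0$ and instantaneous network state information, for every $i\in\mathcal N$ the backlogs $Q_i(t)$, $Z_i(t)$, $S_i(t)$ are, for all $t$, upper bounded by $Q_i^{\max}$, $Z_i^{\max}$, $S_i^{\max}$ respectively, where $$Q_i^{\max}=V(2-e^{-p})+A_i^{\max},\qquad Z_i^{\max}=p(V+\epsilon_i),\qquad S_i^{\max}=Q_i^{\max}+\tfrac1pZ_i^{\max}+c_i^{\max}.$$ Consequently, the age of data at WD $i$ is upper bounded by $$g_i^{\max}=\Big\lceil \tfrac{1}{\epsilon_i}\big(Q_i^{\max}+\tfrac1pZ_i^{\max}\big)\Big\rceil ,$$ where $\lceil\cdot\rceil$ denotes rounding up to the nearest integer.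
   Context: Model. Time is slotted, $t=0,1,2,\dots$, with slots of unit length. There is one access point (AP), indexed $0$, and wireless devices (WDs) $\mathcal N=\{1,\dots,N\}$; $\tilde{\mathcal N}=\{0\}\cup\mathcal N$. In slot $t$ the AP transfers power during a time portion $\mu_0(t)$ and WD $i$ offloads during a time portion $\mu_i(t)$, with (1) $\sum_{i\in\tilde{\mathcal N}}\mu_i(t)\le 1$, $\mu_i(t)\ge 0$ for all $i\in\tilde{\mathcal N}$. The channel gains $h_i(t)>0$ are random, constant within a slot and i.i.d. over slots. With constants $\xi_i\in(0,1)$ and bandwidth, AP transmit power and noise power $W,P_0,N_0>0$, let $\delta_i(t)=\xi_iP_0h_i^2(t)/N_0$. The offloading rate of WD $i$ is $c_i(t)=\mu_i(t)W\log_2\!\big(1+\delta_i(t)\mu_0(t)/\mu_i(t)\big)$ (equal to $0$ if $\mu_i(t)=0$), and it is assumed that $c_i(t)\le c_i^{\max}$ always. The amount of data available for collection at WD $i$ is a random $A_i(t)$, i.i.d. over slots, with $0\le A_i(t)\le A_i^{\max}$; the AP can process at most $r_i(t)$ of WD $i$'s data in slot $t$, where $r_i(t)$ is random with $0\le r_i(t)\le r_i^{\max}$. The collected amount $a_i(t)$ and dropped amount $d_i(t)$ satisfy (2) $0\le a_i(t)\le A_i(t)$; (3) $0\le d_i(t)\le A_i^{\max}$. Queues. With $[x]^+=\max(x,0)$, the data backlogs $Q_i$ (at WD $i$, served first-in-first-out: data are removed, either by offloading or by dropping, in order of collection, with offloading given priority over dropping) and $S_i$ (at the AP) evolve as $Q_i(t+1)=[Q_i(t)-c_i(t)-d_i(t)]^++a_i(t)$,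 $S_i(t+1)=[S_i(t)-r_i(t)]^++\min\{c_i(t),Q_i(t)\}$. Data $a_i(t)$ collected in slot $t$ become processable from slot $t+1$. Virtual queues, with constants $p\ge 1$ and $\epsilon_i\in(0,A_i^{\max}]$, evolve as $Z_i(t+1)=[Z_i(t)-\tfrac1p c_i(t)-p\,d_i(t)+p\,\epsilon_i]^+$. Data age. Data collected by WD $i$ in slot $t_j$ and still queued at WD $i$ in slot $t$ have age $t-t_j$ during slot $t$ (age is constant within a slot). Online algorithm with control parameter $V\ge0$ and instantaneous network state information: in each slot $t$, given the current values $Q_i(t),S_i(t),Z_i(t),h_i(t),A_i(t)$, - $a_i(t)$ minimizes $Q_i(t)a_i(t)-V\log(1+a_i(t))$ (natural logarithm) subject to (2), i.e. $a_i(t)=A_i(t)$ if $V\ge (A_i(t)+1)Q_i(t)$ and $a_i(t)=[V/Q_i(t)-1]^+$ otherwise; - $d_i(t)$ minimizes $[Vp-Q_i(t)-Z_i(t)]d_i(t)$ subject to (3), i.e. $d_i(t)=A_i^{\max}$ if $Q_i(t)+Z_i(t)>Vp$ and $d_i(t)=0$ otherwise; - $(\mu_i(t))_{i\in\tilde{\mathcal N}}$ minimizes $\sum_{i\in\mathcal N}\big[S_i(t)-Q_i(t)-\tfrac1pZ_i(t)\big]c_i(t)$ subject to (1), with $\mu_i(t)=0$ for every $i\in\mathcal N$ such that $S_i(t)-Q_i(t)-\tfrac1pZ_i(t)\ge0$. The queues are then updated by the recursions above. *)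

theory Defs
  imports "HOL-Probability.Probability"
begin

section \<open>System model\<close>

text \<open>Mutual independence over the slots and a common distribution; the constant
  \<open>indep_vars\<close> already includes that every \<open>X t\<close> is measurable.\<close>

definition iid_over_slots :: "'w measure \<Rightarrow> (nat \<Rightarrow> 'w \<Rightarrow> real) \<Rightarrow> bool" where
  "iid_over_slots M X \<longleftrightarrow>
     prob_space.indep_vars M (\<lambda>_. borel) X UNIV \<and>
     (\<forall>t. distr M borel (X t) = distr M borel (X 0))"

definition snr :: "real \<Rightarrow> real \<Rightarrow> real \<Rightarrow> real \<Rightarrow> real" where
  "snr \<xi> P0 N0 h = \<xi> * P0 * h\<^sup>2 / N0"

definition offload_rate :: "real \<Rightarrow> real \<Rightarrow> real \<Rightarrow> real \<Rightarrow> real" where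
  "offload_rate W \<delta> m0 m = (if m = 0 then 0 else m * W * log 2 (1 + \<delta> * m0 / m))"

text \<open>Index \<open>0\<close> is the access point, indices \<open>1..N\<close> are the wireless devices.\<close>

definition time_allocation :: "nat \<Rightarrow> (nat \<Rightarrow> real) \<Rightarrow> bool" where
  "time_allocation N m \<longleftrightarrow> (\<Sum>i=0..N. m i) \<le> 1 \<and> (\<forall>i\<in>{0..N}. 0 \<le> m i)"

section \<open>First-in-first-out data queue and data age\<close>

text \<open>A queue is a list of batches \<open>(s, b)\<close>, oldest first: an amount \<open>b\<close> of the data
  collected in slot \<open>s\<close>. Service takes an amount \<open>x \<ge> 0\<close> from the head of the queue and
  may split a batch.\<close>

fun fifo_remove :: "real \<Rightarrow> (nat \<times> real) list \<Rightarrow> (nat \<times> real) list" where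
  "fifo_remove x [] = []"
| "fifo_remove x ((s, b) # q) =
     (if b \<le> x then fifo_remove (x - b) q else (s, b - x) # q)"

text \<open>Content of the queue at the beginning of slot \<open>t\<close>. In each slot the amount \<open>c\<close> is
  offloaded first, then the amount \<open>d\<close> is dropped from what is left; the data collected in
  the slot are appended last, so they can be served only from the next slot on.\<close>

primrec fifo_queue ::
  "(nat \<Rightarrow> real) \<Rightarrow> (nat \<Rightarrow> real) \<Rightarrow> (nat \<Rightarrow> real) \<Rightarrow> nat \<Rightarrow> (nat \<times> real) list" where
  "fifo_queue c d a 0 = []"
| "fifo_queue c d a (Suc t) =
     fifo_remove (d t) (fifo_remove (c t) (fifo_queue c d a t)) @ [(t, a t)]"

text \<open>Ages, during slot \<open>t\<close>, of the data in the queue; batches of amount \<open>0\<close> hold no data.\<close>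

definition data_ages ::
  "(nat \<Rightarrow> real) \<Rightarrow> (nat \<Rightarrow> real) \<Rightarrow> (nat \<Rightarrow> real) \<Rightarrow> nat \<Rightarrow> int set" where
  "data_ages c d a t =
     {int t - int s | s b. (s, b) \<in> set (fifo_queue c d a t) \<and> 0 < b}"

section \<open>The bounds\<close>

definition Q_max :: "real \<Rightarrow> real \<Rightarrow> real \<Rightarrow> real" where
  "Q_max V p A_max = V * (2 - exp (- p)) + A_max"

definition Z_max :: "real \<Rightarrow> real \<Rightarrow> real \<Rightarrow> real" where
  "Z_max V p \<epsilon> = p * (V + \<epsilon>)"

definition S_max :: "real \<Rightarrow> real \<Rightarrow> real \<Rightarrow> real \<Rightarrow> real \<Rightarrow> real" where
  "S_max V p \<epsilon> A_max c_max = Q_max V p A_max + (1 / p) * Z_max V p \<epsilon> + c_max"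

definition g_max :: "real \<Rightarrow> real \<Rightarrow> real \<Rightarrow> real \<Rightarrow> int" where
  "g_max V p \<epsilon> A_max = \<lceil>(1 / \<epsilon>) * (Q_max V p A_max + (1 / p) * Z_max V p \<epsilon>)\<rceil>"

section \<open>Consistency of the definitions\<close>

text \<open>The total amount in the list-based queue satisfies the scalar backlog recursion.\<close>

lemma fifo_remove_nonneg:
  assumes "\<forall>(s, b)\<in>set q. 0 \<le> b" "0 \<le> x"
  shows "\<forall>(s, b)\<in>set (fifo_remove x q). 0 \<le> b"
  using assms by (induction x q rule: fifo_remove.induct) (auto split: if_splits)

lemma fifo_remove_sum:
  assumes "\<forall>(s, b)\<in>set q. 0 \<le> b" "0 \<le> x"
  shows "sum_list (map snd (fifo_remove x q)) = max 0 (sum_list (map snd q) - x)"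
  using assms
proof (induction x q rule: fifo_remove.induct)
  case (1 x)
  then show ?case by simp
next
  case (2 x s b q)
  have "0 \<le> sum_list (map snd q)"
    using 2(2) by (intro sum_list_nonneg) auto
  then show ?case using 2 by (auto simp: algebra_simps)
qed

lemma fifo_queue_nonneg:
  assumes "\<And>t. 0 \<le> c t" "\<And>t. 0 \<le> d t" "\<And>t. 0 \<le> a t"
  shows "\<forall>(s, b)\<in>set (fifo_queue c d a t). 0 \<le> b"
proof (induction t)
  case (Suc t)
  have "\<forall>(s, b)\<in>set (fifo_remove (d t) (fifo_remove (c t) (fifo_queue c d a t))). 0 \<le> b"
    by (intro fifo_remove_nonneg Suc assms)
  then show ?case using assms(3) by auto
qed simp

lemma fifo_queue_sum:
  assumes "\<And>t. 0 \<le> c t" "\<And>t. 0 \<le> d t" "\<And>t. 0 \<le> a t"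
    and "Q 0 = 0" "\<And>t. Q (Suc t) = max (Q t - c t - d t) 0 + a t"
  shows "sum_list (map snd (fifo_queue c d a t)) = Q t"
proof (induction t)
  case (Suc t)
  have 1: "\<forall>(s, b)\<in>set (fifo_queue c d a t). 0 \<le> b"
    by (intro fifo_queue_nonneg assms)
  have 2: "\<forall>(s, b)\<in>set (fifo_remove (c t) (fifo_queue c d a t)). 0 \<le> b"
    by (intro fifo_remove_nonneg 1 assms)
  show ?case
    using fifo_remove_sum[OF 1 assms(1)] fifo_remove_sum[OF 2 assms(2)] Suc assms(2)[of t]
    by (simp add: assms(5) max_def)
qed (simp add: assms)

text \<open>The closed-form decision rules are instances of the minimizations; the minimizers are
  non-unique only if \<open>Q = V = 0\<close> (collection) or \<open>Q + Z = V * p\<close> (dropping).\<close>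

lemma collect_closed_form:
  fixes Q V A :: real
  assumes "0 \<le> Q" "0 \<le> V" "0 \<le> A"
  shows "is_arg_min (\<lambda>x. Q * x - V * ln (1 + x)) (\<lambda>x. 0 \<le> x \<and> x \<le> A)
           (if V \<ge> (A + 1) * Q then A else max 0 (V / Q - 1))"
proof -
  define y where "y = (if V \<ge> (A + 1) * Q then A else max 0 (V / Q - 1))"
  have Qpos: "0 < Q" if "\<not> V \<ge> (A + 1) * Q"
    using that assms by (cases "Q = 0") auto
  have y: "0 \<le> y" "y \<le> A"
    using assms Qpos by (auto simp: y_def field_simps)
  have "Q * y - V * ln (1 + y) \<le> Q * x - V * ln (1 + x)" if x: "0 \<le> x" "x \<le> A" for x
  proof -
    have "ln (1 + x) - ln (1 + y) \<le> (x - y) / (1 + y)"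
      using ln_diff_le[of "1 + x" "1 + y"] x y by simp
    then have *: "V * (ln (1 + x) - ln (1 + y)) \<le> V * ((x - y) / (1 + y))"
      using assms by (intro mult_left_mono) auto
    have "V * ((x - y) / (1 + y)) = (V / (1 + y)) * (x - y)" by simp
    also have "\<dots> \<le> Q * (x - y)"
    proof (cases "V \<ge> (A + 1) * Q")
      case True
      then have "Q \<le> V / (1 + y)" "x - y \<le> 0"
        using y x assms by (auto simp: y_def field_simps)
      then show ?thesis by (rule mult_right_mono_neg)
    next
      case False
      note q = Qpos[OF False]
      show ?thesis
      proof (cases "V \<ge> Q")
        case True
        then have "y = V / Q - 1" using False q by (simp add: y_def field_simps max_def)
        then show ?thesis using True q by simp
      next
        case nle: False
        then have "y = 0" using False q by (simp add: y_def field_simps max_def)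
        then show ?thesis using nle x by (simp add: mult_right_mono)
      qed
    qed
    finally show ?thesis using * by (simp add: algebra_simps)
  qed
  then show ?thesis
    using y unfolding y_def[symmetric] is_arg_min_def by fastforce
qed

lemma drop_closed_form:
  fixes Q Z V p A_max :: real
  assumes "0 \<le> A_max"
  shows "is_arg_min (\<lambda>x. (V * p - Q - Z) * x) (\<lambda>x. 0 \<le> x \<and> x \<le> A_max)
           (if Q + Z > V * p then A_max else 0)"
  using assms by (auto simp: is_arg_min_def not_less mult_left_mono_neg)

end

theory Submission
  imports Defs
begin

text \<open>Everything happens on a single sample path. Collection stops as soon as \<open>Q \<ge> V\<close>, dropping
  runs at full speed \<open>A_max \<ge> \<epsilon>\<close> as soon as \<open>Z > V p\<close>, and offloading stops as soon as
  \<open>S \<ge> Q + Z / p\<close>; hence each queue stops growing once above its threshold, and it exceeds the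
  threshold by at most one slot's increment. For the age: data of slot \<open>s\<close> still present at the
  beginning of slot \<open>t\<close> forces the service \<open>\<Sum>(c + d)\<close> during \<open>s + 1, \<dots>, t - 1\<close> to be less than
  \<open>Q (s + 1)\<close>, while \<open>Z\<close> gains \<open>p \<epsilon>\<close> in each of these slots and loses at most \<open>p (c + d)\<close>; as
  \<open>Z \<le> Z_max\<close>, there are fewer than \<open>(Q_max + Z_max / p) / \<epsilon>\<close> of them.\<close>

section \<open>Old data in the first-in-first-out queue\<close>

lemma fifo_remove_stamps: "fst ` set (fifo_remove x q) \<subseteq> fst ` set q"
  by (induction x q rule: fifo_remove.induct) auto

text \<open>Service reaches \<open>q2\<close> only after exhausting \<open>q1\<close>, so older data
  evolve as if nothing had arrived behind them.\<close>

lemma fifo_remove_append: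
  "\<exists>q2'. fifo_remove x (q1 @ q2) = fifo_remove x q1 @ q2' \<and> fst ` set q2' \<subseteq> fst ` set q2"
proof (induction x q1 rule: fifo_remove.induct)
  case (1 x)
  then show ?case using fifo_remove_stamps by auto
qed auto

lemma fifo_queue_stamps: "fst ` set (fifo_queue c d a t) \<subseteq> {..<t}"
proof (induction t)
  case (Suc t)
  have "fst ` set (fifo_remove (d t) (fifo_remove (c t) (fifo_queue c d a t))) \<subseteq> {..<t}"
    using fifo_remove_stamps Suc by (meson order_trans)
  then show ?case by (auto simp: subset_iff)
qed simp

text \<open>\<open>old\<close> is what remains of the content at the beginning of slot
  \<open>s + 1\<close>, including the batch of slot \<open>s\<close>; \<open>new\<close> was
  collected later. Standing in front, \<open>old\<close> absorbs all service until it is empty, so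
  its total depends only on the accumulated service.\<close>

lemma fifo_queue_split:
  assumes "\<And>t. 0 \<le> c t" "\<And>t. 0 \<le> d t" "\<And>t. 0 \<le> a t"
  shows "\<exists>old new. fifo_queue c d a (Suc s + k) = old @ new \<and>
      (\<forall>(u, b)\<in>set old. 0 \<le> b) \<and> fst ` set new \<subseteq> {s<..} \<and>
      sum_list (map snd old) =
        max 0 (sum_list (map snd (fifo_queue c d a (Suc s))) - (\<Sum>u=Suc s..<Suc s + k. c u + d u))"
proof (induction k)
  case 0
  have nonneg: "\<forall>(u, b)\<in>set (fifo_queue c d a (Suc s)). 0 \<le> b"
    by (rule fifo_queue_nonneg[OF assms])
  then have "0 \<le> sum_list (map snd (fifo_queue c d a (Suc s)))"
    by (intro sum_list_nonneg) auto
  with nonneg show ?case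
    by (intro exI[of _ "fifo_queue c d a (Suc s)"] exI[of _ "[]"]) auto
next
  case (Suc k)
  define T where "T = Suc s + k"
  from Suc obtain old new where
    split: "fifo_queue c d a T = old @ new" and
    old: "\<forall>(u, b)\<in>set old. 0 \<le> b" and
    new: "fst ` set new \<subseteq> {s<..}" and
    total: "sum_list (map snd old) =
      max 0 (sum_list (map snd (fifo_queue c d a (Suc s))) - (\<Sum>u=Suc s..<T. c u + d u))"
    unfolding T_def by blast
  obtain new1 where new1: "fifo_remove (c T) (old @ new) = fifo_remove (c T) old @ new1"
    "fst ` set new1 \<subseteq> fst ` set new"
    using fifo_remove_append by blast
  obtain new2 where new2: "fifo_remove (d T) (fifo_remove (c T) old @ new1) =
      fifo_remove (d T) (fifo_remove (c T) old) @ new2" "fst ` set new2 \<subseteq> fst ` set new1"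
    using fifo_remove_append by blast
  define old' where "old' = fifo_remove (d T) (fifo_remove (c T) old)"
  have old1: "\<forall>(u, b)\<in>set (fifo_remove (c T) old). 0 \<le> b"
    by (intro fifo_remove_nonneg old assms)
  have "fifo_queue c d a (Suc T) = old' @ (new2 @ [(T, a T)])"
    using split new1 new2 by (simp add: old'_def)
  moreover have "\<forall>(u, b)\<in>set old'. 0 \<le> b"
    unfolding old'_def by (intro fifo_remove_nonneg old1 assms)
  moreover have "fst ` set (new2 @ [(T, a T)]) \<subseteq> {s<..}"
    using new new1(2) new2(2) by (auto simp: T_def)
  moreover have "sum_list (map snd old') =
      max 0 (sum_list (map snd (fifo_queue c d a (Suc s))) - (\<Sum>u=Suc s..<Suc T. c u + d u))"
  proof -
    have "(\<Sum>u=Suc s..<Suc T. c u + d u) = (\<Sum>u=Suc s..<T. c u + d u) + (c T + d T)"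
      by (simp add: T_def)
    \<comment> \<open>The nested truncations collapse into one because both services are
      nonnegative: an empty \<open>old\<close> stays empty.\<close>
    then show ?thesis
      using fifo_remove_sum[OF old assms(1)[of T]] fifo_remove_sum[OF old1 assms(2)[of T]] total
        assms(1)[of T] assms(2)[of T]
      unfolding old'_def by linarith
  qed
  ultimately show ?case unfolding T_def add_Suc_right by blast
qed

text \<open>A positive batch stamped \<open>s\<close> must lie in \<open>old\<close>, whose total is
  then positive; so the truncation in \<open>fifo_queue_split\<close> is inactive. The sum starts at
  \<open>Suc s\<close> because data of slot \<open>s\<close> are servable only from the next slot
  on.\<close>

lemma fifo_service_less_backlog:
  assumes "\<And>t. 0 \<le> c t" "\<And>t. 0 \<le> d t" "\<And>t. 0 \<le> a t"
    and "(s, b) \<in> set (fifo_queue c d a t)" "0 < b"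
  shows "s < t"
    and "(\<Sum>u=Suc s..<t. c u + d u) < sum_list (map snd (fifo_queue c d a (Suc s)))"
proof -
  have "s \<in> fst ` set (fifo_queue c d a t)" using assms(4) by (rule image_eqI[rotated]) simp
  then show "s < t" using fifo_queue_stamps[of c d a t] by blast
  then obtain k where k: "t = Suc s + k" by (metis Suc_leI le_Suc_ex)
  obtain old new where
    split: "fifo_queue c d a t = old @ new" and
    old: "\<forall>(u, b)\<in>set old. 0 \<le> b" and
    new: "fst ` set new \<subseteq> {s<..}" and
    total: "sum_list (map snd old) =
      max 0 (sum_list (map snd (fifo_queue c d a (Suc s))) - (\<Sum>u=Suc s..<t. c u + d u))"
    using fifo_queue_split[where c=c and d=d and a=a and s=s and k=k, OF assms(1-3)]
    unfolding k by blast
  have "(s, b) \<notin> set new"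
  proof
    assume "(s, b) \<in> set new"
    then have "s \<in> fst ` set new" by (rule image_eqI[rotated]) simp
    with new show False by blast
  qed
  then have "(s, b) \<in> set old" using assms(4) unfolding split by simp
  then obtain l1 l2 where l: "old = l1 @ (s, b) # l2" by (blast dest: split_list)
  have "0 \<le> sum_list (map snd l1)" "0 \<le> sum_list (map snd l2)"
    using old unfolding l by (fastforce intro!: sum_list_nonneg)+
  then have "b \<le> sum_list (map snd old)" unfolding l by simp
  then show "(\<Sum>u=Suc s..<t. c u + d u) < sum_list (map snd (fifo_queue c d a (Suc s)))"
    using total assms(5) by linarith
qed

section \<open>Consequences of the decision rules in a single slot\<close>

lemma offload_rate_nonneg:
  assumes "0 \<le> W" "0 \<le> \<delta>" "0 \<le> m0" "0 \<le> m"
  shows "0 \<le> offload_rate W \<delta> m0 m"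
proof -
  have "0 \<le> log 2 (1 + \<delta> * m0 / m)"
    using assms by (auto intro!: zero_le_log_cancel_iff[THEN iffD2] add_pos_nonneg)
  then show ?thesis using assms by (simp add: offload_rate_def)
qed

lemma snr_nonneg: "0 \<le> \<xi> \<Longrightarrow> 0 \<le> P0 \<Longrightarrow> 0 \<le> N0 \<Longrightarrow> 0 \<le> snr \<xi> P0 N0 h"
  by (simp add: snr_def)

text \<open>The objective vanishes at the feasible point \<open>0\<close> and is positive at every
  \<open>x > 0\<close>: by \<open>ln (1 + x) < x\<close> if \<open>V > 0\<close>, and by
  \<open>Q > 0\<close> if \<open>V = 0\<close>. For \<open>Q = V = 0\<close> every feasible point
  would be a minimizer.\<close>

lemma collect_eq_0:
  fixes Q V A x :: real
  assumes min: "is_arg_min (\<lambda>x. Q * x - V * ln (1 + x)) (\<lambda>x. 0 \<le> x \<and> x \<le> A) x"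
    and "0 \<le> V" "V \<le> Q" "0 < Q"
  shows "x = 0"
proof (rule ccontr)
  assume "x \<noteq> 0"
  with min have x: "0 < x" "x \<le> A" by (auto simp: is_arg_min_def)
  have "V * ln (1 + x) < Q * x"
  proof (cases "V = 0")
    case False
    have "V * ln (1 + x) < V * x"
      using x False assms(2) by (intro mult_strict_left_mono ln_add_one_self_less_self) auto
    also have "\<dots> \<le> Q * x" using x assms(3) by (intro mult_right_mono) auto
    finally show ?thesis .
  qed (use x assms(4) in simp)
  moreover have "\<not> Q * 0 - V * ln (1 + 0) < Q * x - V * ln (1 + x)"
    using min x unfolding is_arg_min_def by (metis order.refl less_imp_le order_trans)
  ultimately show False by simp
qed

lemma drop_eq_max:
  fixes k A x :: real
  assumes min: "is_arg_min (\<lambda>x. k * x) (\<lambda>x. 0 \<le> x \<and> x \<le> A) x" and "k < 0"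
  shows "x = A"
proof -
  have x: "0 \<le> x" "x \<le> A" and "\<not> k * A < k * x"
    using min by (auto simp: is_arg_min_def)
  then show ?thesis using \<open>k < 0\<close> by (simp add: mult_less_cancel_left)
qed

text \<open>One device on one sample path, so all sequences are deterministic. The time allocation
  shared by the devices is reflected only in \<open>c_nonneg\<close>, \<open>c_le\<close> and
  \<open>idle\<close>.\<close>

locale online_queue =
  fixes V p \<epsilon> A_max c_max :: real and A r c a d Q S Z :: "nat \<Rightarrow> real"
  assumes V_nonneg: "0 \<le> V" and p_ge_1: "1 \<le> p"
    and eps_pos: "0 < \<epsilon>" and eps_le: "\<epsilon> \<le> A_max"
    and A_le: "A t \<le> A_max" and r_nonneg: "0 \<le> r t"
    and c_nonneg: "0 \<le> c t" and c_le: "c t \<le> c_max"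
    and Q_0: "Q 0 = 0" and S_0: "S 0 = 0" and Z_0: "Z 0 = 0"
    and Q_Suc: "Q (Suc t) = max (Q t - c t - d t) 0 + a t"
    and S_Suc: "S (Suc t) = max (S t - r t) 0 + min (c t) (Q t)"
    and Z_Suc: "Z (Suc t) = max (Z t - (1 / p) * c t - p * d t + p * \<epsilon>) 0"
    and collect: "is_arg_min (\<lambda>x. Q t * x - V * ln (1 + x)) (\<lambda>x. 0 \<le> x \<and> x \<le> A t) (a t)"
    and dropping: "is_arg_min (\<lambda>x. (V * p - Q t - Z t) * x) (\<lambda>x. 0 \<le> x \<and> x \<le> A_max) (d t)"
    and idle: "S t - Q t - (1 / p) * Z t \<ge> 0 \<Longrightarrow> c t = 0"
begin

section \<open>Backlog bounds\<close>

lemma a_nonneg: "0 \<le> a t" and a_le: "a t \<le> A_max"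
  using collect[of t] A_le[of t] by (auto simp: is_arg_min_def)

lemma d_nonneg: "0 \<le> d t"
  using dropping[of t] by (simp add: is_arg_min_def)

lemma Q_nonneg: "0 \<le> Q t"
  using a_nonneg by (cases t) (auto simp: Q_0 Q_Suc add_nonneg_nonneg)

lemma Z_nonneg: "0 \<le> Z t"
  by (cases t) (auto simp: Z_0 Z_Suc)

lemma S_nonneg: "0 \<le> S t"
  using c_nonneg Q_nonneg by (cases t) (auto simp: S_0 S_Suc add_nonneg_nonneg)

lemma Q_le_V: "Q t \<le> V + A_max"
proof (induction t)
  case 0
  then show ?case using V_nonneg eps_pos eps_le by (simp add: Q_0)
next
  case (Suc t)
  show ?case
  \<comment> \<open>The degenerate slot with \<open>V = Q t = 0\<close>, where collection need not
    stop, falls into the second case, since there \<open>Q t <= V\<close>.\<close>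
  proof (cases "V \<le> Q t \<and> 0 < Q t")
    case True
    then have "a t = 0" using collect_eq_0[OF collect V_nonneg] by blast
    then show ?thesis
      using Suc c_nonneg[of t] d_nonneg[of t] Q_nonneg[of t] by (simp add: Q_Suc)
  next
    case False
    then have "Q t \<le> V" using Q_nonneg[of t] V_nonneg by linarith
    then show ?thesis
      using a_le[of t] c_nonneg[of t] d_nonneg[of t] V_nonneg by (simp add: Q_Suc)
  qed
qed

lemma Q_le: "Q t \<le> Q_max V p A_max"
proof -
  \<comment> \<open>As \<open>exp (- p) <= 1\<close>, \<open>Q_max\<close> relaxes the bound
    \<open>V + A_max\<close>.\<close>
  have "V * 1 \<le> V * (2 - exp (- p))"
    using V_nonneg p_ge_1 by (intro mult_left_mono) auto
  then show ?thesis using Q_le_V[of t] by (simp add: Q_max_def)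
qed

lemma Z_le: "Z t \<le> Z_max V p \<epsilon>"
proof (induction t)
  case 0
  then show ?case using V_nonneg p_ge_1 eps_pos by (simp add: Z_0 Z_max_def)
next
  case (Suc t)
  have pc: "0 \<le> (1 / p) * c t" and pd: "0 \<le> p * d t" and pe: "0 \<le> p * \<epsilon>" and pV: "0 \<le> V * p"
    using p_ge_1 c_nonneg[of t] d_nonneg[of t] eps_pos V_nonneg by auto
  have Zm: "Z_max V p \<epsilon> = V * p + p * \<epsilon>" by (simp add: Z_max_def algebra_simps)
  show ?case
  proof (cases "Z t \<le> V * p")
    case True
    then show ?thesis using pc pd pe pV unfolding Z_Suc Zm by linarith
  next
    case False
    \<comment> \<open>With \<open>Q t >= 0\<close>, the excess of \<open>Z t\<close> over
      \<open>V * p\<close> makes the slope of the dropping objective negative.\<close>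
    then have "d t = A_max" using drop_eq_max[OF dropping] Q_nonneg[of t] by force
    then have "p * \<epsilon> \<le> p * d t" using eps_le p_ge_1 by simp
    then show ?thesis using Suc pc Z_nonneg[of t] unfolding Z_Suc by linarith
  qed
qed

lemma S_le: "S t \<le> S_max V p \<epsilon> A_max c_max"
proof (induction t)
  case 0
  have "0 \<le> (1 / p) * Z_max V p \<epsilon>"
    using p_ge_1 Z_nonneg[of 0] Z_le[of 0] by simp
  then show ?case
    using Q_nonneg[of 0] Q_le[of 0] c_nonneg[of 0] c_le[of 0] by (simp add: S_0 S_max_def)
next
  case (Suc t)
  show ?case
  proof (cases "S t - Q t - (1 / p) * Z t \<ge> 0")
    case True
    then have "S (Suc t) \<le> S t"
      using idle Q_nonneg[of t] r_nonneg[of t] S_nonneg[of t] by (simp add: S_Suc)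
    then show ?thesis using Suc by linarith
  next
    case False
    have "(1 / p) * Z t \<le> (1 / p) * Z_max V p \<epsilon>"
      using Z_le[of t] p_ge_1 by (intro mult_left_mono) auto
    \<comment> \<open>Here \<open>S t\<close> lies below \<open>Q t + Z t / p\<close>, and the
      inflow \<open>min (c t) (Q t)\<close> adds at most \<open>c_max\<close>.\<close>
    then show ?thesis
      using False Q_le[of t] c_le[of t] r_nonneg[of t] S_nonneg[of t]
      unfolding S_Suc S_max_def by linarith
  qed
qed

section \<open>Data age\<close>

lemma Z_drift: "Z (T + k) \<ge> Z T + real k * (p * \<epsilon>) - p * (\<Sum>u=T..<T + k. c u + d u)"
proof (induction k)
  case (Suc k)
  \<comment> \<open>From \<open>1 / p <= 1 <= p\<close>: giving offloading the weight
    \<open>p\<close> of dropping turns the loss of \<open>Z\<close> into a multiple of the FIFO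
    service \<open>c + d\<close>. Truncation at \<open>0\<close> only raises
    \<open>Z\<close>.\<close>
  have "(1 / p) * c (T + k) \<le> p * c (T + k)"
    using p_ge_1 c_nonneg[of "T + k"]
    by (intro mult_right_mono) (auto intro: order_trans[of _ 1])
  then have "Z (Suc (T + k)) \<ge> Z (T + k) + p * \<epsilon> - p * (c (T + k) + d (T + k))"
    unfolding Z_Suc by (simp add: algebra_simps)
  then show ?case using Suc by (simp add: algebra_simps)
qed simp

lemma age_le:
  assumes "g \<in> data_ages c d a t"
  shows "g \<le> g_max V p \<epsilon> A_max"
proof -
  obtain s b where g: "g = int t - int s" and
    sb: "(s, b) \<in> set (fifo_queue c d a t)" "0 < b"
    using assms by (auto simp: data_ages_def)
  note fifo = fifo_service_less_backlog[OF c_nonneg d_nonneg a_nonneg sb]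
  \<comment> \<open>\<open>k\<close> counts the service slots from \<open>s + 1\<close> to
    \<open>t - 1\<close>; the age is \<open>k + 1\<close>.\<close>
  from fifo(1) obtain k where k: "t = Suc s + k" by (metis Suc_leI le_Suc_ex)
  have "(\<Sum>u=Suc s..<Suc s + k. c u + d u) < Q (Suc s)"
    using fifo(2) fifo_queue_sum[OF c_nonneg d_nonneg a_nonneg Q_0 Q_Suc]
    unfolding k by metis
  then have "(\<Sum>u=Suc s..<Suc s + k. c u + d u) < Q_max V p A_max"
    using Q_le[of "Suc s"] by linarith
  then have "p * (\<Sum>u=Suc s..<Suc s + k. c u + d u) < p * Q_max V p A_max"
    using p_ge_1 by (intro mult_strict_left_mono) auto
  then have "real k * (p * \<epsilon>) < p * Q_max V p A_max + Z_max V p \<epsilon>"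
    using Z_drift[where T="Suc s" and k=k] Z_nonneg[of "Suc s"] Z_le[of "Suc s + k"] by linarith
  then have "real k < (1 / \<epsilon>) * (Q_max V p A_max + (1 / p) * Z_max V p \<epsilon>)"
    using p_ge_1 eps_pos by (simp add: field_simps)
  \<comment> \<open>Strictness pays for the off-by-one: an integer strictly below a real is strictly
    below its ceiling, so \<open>k + 1\<close> is still at most \<open>g_max\<close>.\<close>
  then have "int k < g_max V p \<epsilon> A_max"
    unfolding g_max_def by (simp add: less_ceiling_iff)
  then show ?thesis by (simp add: g k)
qed

end

section \<open>Transfer to all devices and sample paths\<close>

theorem theorem2:
  fixes M :: "'w measure"
    and N :: nat
    and W P0 N0 V p :: real
    and \<xi> \<epsilon> A_max r_max c_max :: "nat \<Rightarrow> real"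
    and h A r \<mu> c a d Q S Z :: "nat \<Rightarrow> nat \<Rightarrow> 'w \<Rightarrow> real"
  assumes prob: "prob_space M"
    and params: "0 < W" "0 < P0" "0 < N0" "0 \<le> V" "1 \<le> p"
    and xi: "\<And>i. i \<in> {1..N} \<Longrightarrow> 0 < \<xi> i \<and> \<xi> i < 1"
    and eps: "\<And>i. i \<in> {1..N} \<Longrightarrow> 0 < \<epsilon> i \<and> \<epsilon> i \<le> A_max i"
    and h_iid: "\<And>i. i \<in> {1..N} \<Longrightarrow> iid_over_slots M (h i)"
    and A_iid: "\<And>i. i \<in> {1..N} \<Longrightarrow> iid_over_slots M (A i)"
    and r_rv: "\<And>i t. i \<in> {1..N} \<Longrightarrow> r i t \<in> borel_measurable M"
    and h_pos: "\<And>i t \<omega>. i \<in> {1..N} \<Longrightarrow> \<omega> \<in> space M \<Longrightarrow> 0 < h i t \<omega>"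
    and A_bound: "\<And>i t \<omega>. i \<in> {1..N} \<Longrightarrow> \<omega> \<in> space M \<Longrightarrow> 0 \<le> A i t \<omega> \<and> A i t \<omega> \<le> A_max i"
    and r_bound: "\<And>i t \<omega>. i \<in> {1..N} \<Longrightarrow> \<omega> \<in> space M \<Longrightarrow> 0 \<le> r i t \<omega> \<and> r i t \<omega> \<le> r_max i"
    and c_rate: "\<And>i t \<omega>. i \<in> {1..N} \<Longrightarrow> \<omega> \<in> space M \<Longrightarrow>
        c i t \<omega> = offload_rate W (snr (\<xi> i) P0 N0 (h i t \<omega>)) (\<mu> 0 t \<omega>) (\<mu> i t \<omega>)"
    and c_bound: "\<And>i t \<omega>. i \<in> {1..N} \<Longrightarrow> \<omega> \<in> space M \<Longrightarrow> c i t \<omega> \<le> c_max i"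
    and init: "\<And>i \<omega>. i \<in> {1..N} \<Longrightarrow> \<omega> \<in> space M \<Longrightarrow> Q i 0 \<omega> = 0 \<and> S i 0 \<omega> = 0 \<and> Z i 0 \<omega> = 0"
    and Q_step: "\<And>i t \<omega>. i \<in> {1..N} \<Longrightarrow> \<omega> \<in> space M \<Longrightarrow>
        Q i (Suc t) \<omega> = max (Q i t \<omega> - c i t \<omega> - d i t \<omega>) 0 + a i t \<omega>"
    and S_step: "\<And>i t \<omega>. i \<in> {1..N} \<Longrightarrow> \<omega> \<in> space M \<Longrightarrow>
        S i (Suc t) \<omega> = max (S i t \<omega> - r i t \<omega>) 0 + min (c i t \<omega>) (Q i t \<omega>)"
    and Z_step: "\<And>i t \<omega>. i \<in> {1..N} \<Longrightarrow> \<omega> \<in> space M \<Longrightarrow>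
        Z i (Suc t) \<omega> = max (Z i t \<omega> - (1 / p) * c i t \<omega> - p * d i t \<omega> + p * \<epsilon> i) 0"
    and collect: "\<And>i t \<omega>. i \<in> {1..N} \<Longrightarrow> \<omega> \<in> space M \<Longrightarrow>
        is_arg_min (\<lambda>x. Q i t \<omega> * x - V * ln (1 + x)) (\<lambda>x. 0 \<le> x \<and> x \<le> A i t \<omega>) (a i t \<omega>)"
    and dropping: "\<And>i t \<omega>. i \<in> {1..N} \<Longrightarrow> \<omega> \<in> space M \<Longrightarrow>
        is_arg_min (\<lambda>x. (V * p - Q i t \<omega> - Z i t \<omega>) * x) (\<lambda>x. 0 \<le> x \<and> x \<le> A_max i) (d i t \<omega>)"
    and allocate: "\<And>t \<omega>. \<omega> \<in> space M \<Longrightarrow>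
        is_arg_min
          (\<lambda>m. \<Sum>i=1..N. (S i t \<omega> - Q i t \<omega> - (1 / p) * Z i t \<omega>) *
                 offload_rate W (snr (\<xi> i) P0 N0 (h i t \<omega>)) (m 0) (m i))
          (time_allocation N) (\<lambda>i. \<mu> i t \<omega>)"
    and allocate_zero: "\<And>i t \<omega>. i \<in> {1..N} \<Longrightarrow> \<omega> \<in> space M \<Longrightarrow>
        S i t \<omega> - Q i t \<omega> - (1 / p) * Z i t \<omega> \<ge> 0 \<Longrightarrow> \<mu> i t \<omega> = 0"
  shows "\<forall>i\<in>{1..N}. \<forall>\<omega>\<in>space M.
      (\<forall>t. Q i t \<omega> \<le> Q_max V p (A_max i) \<and>
           Z i t \<omega> \<le> Z_max V p (\<epsilon> i) \<and>
           S i t \<omega> \<le> S_max V p (\<epsilon> i) (A_max i) (c_max i)) \<and>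
      (\<forall>t. \<forall>g\<in>data_ages (\<lambda>t. c i t \<omega>) (\<lambda>t. d i t \<omega>) (\<lambda>t. a i t \<omega>) t.
           g \<le> g_max V p (\<epsilon> i) (A_max i))"
proof (intro ballI)
  fix i \<omega>
  assume i: "i \<in> {1..N}" and \<omega>: "\<omega> \<in> space M"
  have c_nonneg: "0 \<le> c i t \<omega>" for t
  proof -
    have "time_allocation N (\<lambda>j. \<mu> j t \<omega>)"
      using allocate[OF \<omega>, of t] by (simp add: is_arg_min_def)
    then have "0 \<le> \<mu> 0 t \<omega>" "0 \<le> \<mu> i t \<omega>" using i by (auto simp: time_allocation_def)
    then show ?thesis
      using params xi[OF i] unfolding c_rate[OF i \<omega>]
      by (intro offload_rate_nonneg snr_nonneg) auto
  qed
  \<comment> \<open>A zero time portion gives rate \<open>0\<close> by the separate case in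
    \<open>offload_rate\<close>.\<close>
  have idle: "c i t \<omega> = 0" if "S i t \<omega> - Q i t \<omega> - (1 / p) * Z i t \<omega> \<ge> 0" for t
    using allocate_zero[OF i \<omega> that] by (simp add: c_rate[OF i \<omega>] offload_rate_def)
  note bounds = params eps[OF i, THEN conjunct1] eps[OF i, THEN conjunct2]
    A_bound[OF i \<omega>, THEN conjunct2] r_bound[OF i \<omega>, THEN conjunct1]
    init[OF i \<omega>, THEN conjunct1] init[OF i \<omega>, THEN conjunct2, THEN conjunct1]
    init[OF i \<omega>, THEN conjunct2, THEN conjunct2]
  interpret online_queue V p "\<epsilon> i" "A_max i" "c_max i" "\<lambda>t. A i t \<omega>" "\<lambda>t. r i t \<omega>"
    "\<lambda>t. c i t \<omega>" "\<lambda>t. a i t \<omega>" "\<lambda>t. d i t \<omega>" "\<lambda>t. Q i t \<omega>" "\<lambda>t. S i t \<omega>" "\<lambda>t. Z i t \<omega>"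
    by unfold_locales
      (fact bounds c_nonneg c_bound[OF i \<omega>] Q_step[OF i \<omega>] S_step[OF i \<omega>] Z_step[OF i \<omega>]
        collect[OF i \<omega>] dropping[OF i \<omega>] idle)+
  show "(\<forall>t. Q i t \<omega> \<le> Q_max V p (A_max i) \<and>
           Z i t \<omega> \<le> Z_max V p (\<epsilon> i) \<and>
           S i t \<omega> \<le> S_max V p (\<epsilon> i) (A_max i) (c_max i)) \<and>
      (\<forall>t. \<forall>g\<in>data_ages (\<lambda>t. c i t \<omega>) (\<lambda>t. d i t \<omega>) (\<lambda>t. a i t \<omega>) t.
           g \<le> g_max V p (\<epsilon> i) (A_max i))"
    using Q_le Z_le S_le age_le by blast
qed

end
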